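(* Let $d \ge 0$ be an integer and let $f(x)=\sum_{i=0}^d b_i x^i$ be a polynomial of degree $d$ with positive real coefficients, i.e. $b_i>0$ for all $0\le i\le d$. If $k$ is a positive real number such that the polynomial $f(kx)$ (in the variable $x$) is magic positive, then $f(k'x)$ is magic positive for every real number $k'\ge k$.
   Context: A polynomial $g(x)\in\mathbb{R}[x]$ of degree $d$ is called magic positive if, in its unique expansion $g(x)=\sum_{i=0}^d a_i\,x^i(x+1)^{d-i}$ with respect to the basis $\{x^i(x+1)^{d-i}\}_{i=0}^d$ of the real polynomials of degree at most $d$, all coefficients satisfy $a_i\ge 0$. *)

theory Defs
  imports "HOL-Computational_Algebra.Polynomial"
begin

definition magic_positive :: "real poly \<Rightarrow> bool" where
  "magic_positive g \<longleftrightarrow>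
     (\<exists>a :: nat \<Rightarrow> real.
        g = (\<Sum>i\<le>degree g. smult (a i) ([:0, 1:] ^ i * [:1, 1:] ^ (degree g - i))) \<and>
        (\<forall>i\<le>degree g. a i \<ge> 0))"

text \<open>The expansion exists and is unique, so the existential quantifier in the definition above
  speaks about the coefficients of \<^emph>\<open>the\<close> expansion. (The zero polynomial, whose degree is 0 in
  this library, counts as magic positive.)\<close>

lemma magic_expansion_Suc:
  fixes a :: "nat \<Rightarrow> real"
  shows "(\<Sum>i\<le>Suc d. smult (a i) ([:0, 1:] ^ i * [:1, 1:] ^ (Suc d - i))) =
         smult (a 0) ([:1, 1:] ^ Suc d) +
         [:0, 1:] * (\<Sum>i\<le>d. smult (a (Suc i)) ([:0, 1:] ^ i * [:1, 1:] ^ (d - i)))"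
  by (simp only: sum.atMost_Suc_shift sum_distrib_left) (simp add: mult.assoc)

lemma magic_expansion_exists:
  fixes g :: "real poly"
  assumes "degree g \<le> d"
  shows "\<exists>a. g = (\<Sum>i\<le>d. smult (a i) ([:0, 1:] ^ i * [:1, 1:] ^ (d - i)))"
  using assms
proof (induction d arbitrary: g)
  case 0
  then obtain c where "g = [:c:]" by (meson degree_eq_zeroE le_zero_eq)
  then show ?case by (intro exI[of _ "\<lambda>_. c"]) simp
next
  case (Suc d)
  define c where "c = poly g 0"
  define r where "r = g - smult c ([:1, 1:] ^ Suc d)"
  have "poly r 0 = 0" by (simp add: r_def c_def)
  then obtain h where h: "r = [:0, 1:] * h"
    using poly_eq_0_iff_dvd[of r 0] by (auto elim: dvdE)
  have "degree ([:1, 1:] ^ Suc d :: real poly) \<le> Suc d"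
    using degree_power_le[of "[:1, 1:] :: real poly" "Suc d"] by simp
  then have "degree r \<le> Suc d"
    unfolding r_def using Suc.prems by (intro degree_diff_le order_trans[OF degree_smult_le])
  then have "degree h \<le> d" using h by (cases "h = 0") auto
  from Suc.IH[OF this] obtain a where
    a: "h = (\<Sum>i\<le>d. smult (a i) ([:0, 1:] ^ i * [:1, 1:] ^ (d - i)))" by blast
  have "g = smult c ([:1, 1:] ^ Suc d) + [:0, 1:] * h" using h by (simp add: r_def algebra_simps)
  then show ?case
    by (intro exI[of _ "case_nat c a"]) (simp only: magic_expansion_Suc nat.case a)
qed

lemma magic_expansion_unique:
  fixes a b :: "nat \<Rightarrow> real"
  assumes "(\<Sum>i\<le>d. smult (a i) ([:0, 1:] ^ i * [:1, 1:] ^ (d - i))) =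
           (\<Sum>i\<le>d. smult (b i) ([:0, 1:] ^ i * [:1, 1:] ^ (d - i)))"
    and "i \<le> d"
  shows "a i = b i"
  using assms
proof (induction d arbitrary: a b i)
  case 0
  then show ?case by simp
next
  case (Suc d)
  note eq = Suc.prems(1)[unfolded magic_expansion_Suc]
  from arg_cong[OF eq, of "\<lambda>p. poly p 0"] have 0: "a 0 = b 0" by simp
  with eq have "(\<Sum>i\<le>d. smult (a (Suc i)) ([:0, 1:] ^ i * [:1, 1:] ^ (d - i))) =
      (\<Sum>i\<le>d. smult (b (Suc i)) ([:0, 1:] ^ i * [:1, 1:] ^ (d - i)))"
    by simp
  from Suc.IH[OF this] Suc.prems(2) 0 show ?case by (cases i) auto
qed

end

theory Submission
  imports Defs
begin

text \<open>Substituting \<open>c x\<close> for \<open>x\<close> turns the basis element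
  \<open>x^i (x + 1)^(d - i)\<close> into \<open>c^i x^i (c x + 1)^(d - i)\<close>. Since \<open>c x + 1 = (x + 1) + (c - 1) x\<close>,
  for \<open>c \<ge> 1\<close> this is a nonnegative combination of basis elements of the same degree; apply this
  to \<open>f(k x)\<close> with \<open>c = k' / k\<close>.\<close>

text \<open>The index \<open>d\<close> is a parameter of its own rather than the degree of the
  member. Sums and intermediate products can thus be handled in one fixed convex cone; degrees enter
  only through \<open>magic_positive_iff\<close>.\<close>

definition magic_cone :: "nat \<Rightarrow> real poly set" where
  "magic_cone d =
     {(\<Sum>i\<le>d. smult (a i) ([:0, 1:] ^ i * [:1, 1:] ^ (d - i))) | a. \<forall>i\<le>d. a i \<ge> 0}"

lemma magic_positive_iff: "magic_positive g \<longleftrightarrow> g \<in> magic_cone (degree g)"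
  unfolding magic_positive_def magic_cone_def by blast

lemma magic_cone_zero: "0 \<in> magic_cone d"
  unfolding magic_cone_def by (auto intro!: exI[of _ "\<lambda>_. 0"])

lemma magic_cone_add:
  assumes "p \<in> magic_cone d" "q \<in> magic_cone d"
  shows "p + q \<in> magic_cone d"
proof -
  obtain a b where "\<forall>i\<le>d. a i \<ge> 0" "\<forall>i\<le>d. b i \<ge> 0"
    "p = (\<Sum>i\<le>d. smult (a i) ([:0, 1:] ^ i * [:1, 1:] ^ (d - i)))"
    "q = (\<Sum>i\<le>d. smult (b i) ([:0, 1:] ^ i * [:1, 1:] ^ (d - i)))"
    using assms unfolding magic_cone_def by blast
  then show ?thesis
    unfolding magic_cone_def
    by (auto intro!: exI[of _ "\<lambda>i. a i + b i"] simp: smult_add_left sum.distrib)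
qed

lemma magic_cone_smult:
  assumes "p \<in> magic_cone d" "c \<ge> 0"
  shows "smult c p \<in> magic_cone d"
proof -
  obtain a where "\<forall>i\<le>d. a i \<ge> 0"
    "p = (\<Sum>i\<le>d. smult (a i) ([:0, 1:] ^ i * [:1, 1:] ^ (d - i)))"
    using assms unfolding magic_cone_def by blast
  moreover have "smult c (\<Sum>i\<le>d. q i) = (\<Sum>i\<le>d. smult c (q i))" for q :: "nat \<Rightarrow> real poly"
    by (induction d) (simp_all add: smult_add_right)
  ultimately show ?thesis
    unfolding magic_cone_def using \<open>c \<ge> 0\<close>
    by (auto intro!: exI[of _ "\<lambda>i. c * a i"])
qed

lemma magic_cone_sum:
  "(\<And>i. i \<in> I \<Longrightarrow> p i \<in> magic_cone d) \<Longrightarrow> (\<Sum>i\<in>I. p i) \<in> magic_cone d"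
  \<comment> \<open>Over an infinite \<open>I\<close> the sum is 0 by convention, so that case also
    falls to \<open>magic_cone_zero\<close>.\<close>
  by (induction I rule: infinite_finite_induct) (auto intro: magic_cone_zero magic_cone_add)

lemma magic_cone_basis: "[:0, 1:] ^ i * [:1, 1:] ^ j \<in> magic_cone (i + j)"
proof -
  have "(\<Sum>l\<le>i + j. smult (if l = i then 1 else 0) ([:0, 1:] ^ l * [:1, 1:] ^ (i + j - l))) =
      (\<Sum>l\<le>i + j. if l = i then [:0, 1:] ^ l * [:1, 1::real:] ^ (i + j - l) else 0)"
    by (intro sum.cong) auto
  also have "\<dots> = [:0, 1:] ^ i * [:1, 1:] ^ j"
    by simp
  finally show ?thesis
    unfolding magic_cone_def by (auto intro!: exI[of _ "\<lambda>l. if l = i then 1 else 0"])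
qed

text \<open>The induction on \<open>n\<close> splits off one factor \<open>[:1, c:]\<close> at a
  time. One summand raises \<open>j\<close>, the other raises \<open>i\<close>, so both must be
  arbitrary; the total exponent is preserved, and the weights 1 and \<open>c - 1\<close> are
  nonnegative.\<close>

lemma magic_cone_dilated_basis:
  assumes "c \<ge> 1"
  shows "[:0, 1:] ^ i * [:1, 1:] ^ j * [:1, c:] ^ n \<in> magic_cone (i + j + n)"
proof (induction n arbitrary: i j)
  case 0
  then show ?case using magic_cone_basis by simp
next
  case (Suc n)
  have "[:1, c:] = [:1, 1:] + smult (c - 1) [:0, 1:]"
    by simp
  then have "[:0, 1:] ^ i * [:1, 1:] ^ j * [:1, c:] ^ Suc n =
      [:0, 1:] ^ i * [:1, 1:] ^ j * [:1, c:] ^ n * ([:1, 1:] + smult (c - 1) [:0, 1:])"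
    by (simp only: power_Suc2 mult.assoc)
  also have "\<dots> = [:0, 1:] ^ i * [:1, 1:] ^ Suc j * [:1, c:] ^ n +
      smult (c - 1) ([:0, 1:] ^ Suc i * [:1, 1:] ^ j * [:1, c:] ^ n)"
    by (simp only: distrib_left mult_smult_right power_Suc mult_ac)
  also have "\<dots> \<in> magic_cone (i + j + Suc n)"
    using Suc.IH[of i "Suc j"] Suc.IH[of "Suc i" j] assms
    by (intro magic_cone_add magic_cone_smult) simp_all
  finally show ?case .
qed

lemma magic_cone_dilation:
  assumes "p \<in> magic_cone d" "c \<ge> 1"
  shows "pcompose p [:0, c:] \<in> magic_cone d"
proof -
  obtain a where a: "\<forall>i\<le>d. a i \<ge> 0"
    and p: "p = (\<Sum>i\<le>d. smult (a i) ([:0, 1:] ^ i * [:1, 1:] ^ (d - i)))"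
    using assms unfolding magic_cone_def by blast
  have pow: "pcompose (q ^ n) r = pcompose q r ^ n" for q r :: "real poly" and n
    by (induction n) (simp_all add: pcompose_mult pcompose_1)
  have c: "[:0, c:] = smult c [:0, 1:]"
    by simp
  have "pcompose p [:0, c:] = (\<Sum>i\<le>d. smult (a i) ([:0, c:] ^ i * [:1, c:] ^ (d - i)))"
    by (simp add: p pcompose_sum pcompose_smult pcompose_mult pow pcompose_pCons)
  \<comment> \<open>Moving \<open>c ^ i\<close> into the coefficient leaves the case
    \<open>j = 0\<close> of \<open>magic_cone_dilated_basis\<close>.\<close>
  also have "\<dots> = (\<Sum>i\<le>d. smult (a i * c ^ i) ([:0, 1:] ^ i * [:1, c:] ^ (d - i)))"
    by (simp only: c smult_power mult_smult_left smult_smult)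
  also have "\<dots> \<in> magic_cone d"
  proof (intro magic_cone_sum magic_cone_smult)
    fix i assume "i \<in> {..d}"
    then show "[:0, 1:] ^ i * [:1, c:] ^ (d - i) \<in> magic_cone d" "a i * c ^ i \<ge> 0"
      using magic_cone_dilated_basis[OF \<open>c \<ge> 1\<close>, of i 0 "d - i"] a \<open>c \<ge> 1\<close> by auto
  qed
  finally show ?thesis .
qed

theorem theorem1p4:
  fixes d :: nat and f :: "real poly" and k k' :: real
  assumes "degree f = d"
    and "\<forall>i\<le>d. coeff f i > 0"
    and "k > 0"
    and "magic_positive (pcompose f [:0, k:])"
    and "k' \<ge> k"
  shows "magic_positive (pcompose f [:0, k':])"
proof -
  have "[:0, k':] = pcompose [:0, k:] [:0, k' / k:]"
    using \<open>k > 0\<close> by (simp add: pcompose_pCons)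
  then have "pcompose f [:0, k':] = pcompose (pcompose f [:0, k:]) [:0, k' / k:]"
    by (simp only: pcompose_assoc)
  \<comment> \<open>Since \<open>k\<close> and \<open>k'\<close> are positive, both dilations have
    the degree of \<open>f\<close>, so the hypothesis and the goal concern the same cone.\<close>
  also have "\<dots> \<in> magic_cone (degree f)"
  proof (rule magic_cone_dilation)
    show "pcompose f [:0, k:] \<in> magic_cone (degree f)"
      using assms by (simp add: magic_positive_iff degree_pcompose)
    show "k' / k \<ge> 1"
      using assms by simp
  qed
  finally show ?thesis
    using assms by (simp add: magic_positive_iff degree_pcompose)
qed

end
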